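(* (Chinese Remainder Theorem for Gaussian lines.) Let $L$ be a primitive Gaussian line with Gaussian integers $\alpha_n=\alpha_0+\delta n$, $n\in\mathbb{Z}$, and suppose $\mu_1,\mu_2,\ldots,\mu_k$ are Gaussian integers in the divisor set $\mathcal{D}(L)$ of $L$ such that $\nu(\mu_1),\nu(\mu_2),\ldots,\nu(\mu_k)$ are pairwise relatively prime. Let $b_1,b_2,\ldots,b_k$ be arbitrary rational integers. Then there is a unique rational integer $t$ modulo $\nu(\mu_1)\nu(\mu_2)\cdots\nu(\mu_k)$ such that $$\mu_1\mid\alpha_{t+b_1},\ \mu_2\mid\alpha_{t+b_2},\ \ldots,\ \mu_k\mid\alpha_{t+b_k}.$$
   Context: A Gaussian line is a line in the complex plane containing at least two (hence infinitely many) elements of $\mathbb{Z}[i]$. It is primitive if the Gaussian integers on it do not all share a common non-unit divisor in $\mathbb{Z}[i]$. For a Gaussian line $L$, $\alpha_0=a+bi$ denotes the Gaussian integer on $L$ of minimum norm $N(x+iy)=x^2+y^2$ (if there are two, the one with larger real part). If $L$ is vertical, $\delta=i$; otherwise $\delta=c+di=\alpha_1-\alpha_0$, where $\alpha_1$ is the Gaussian integer on $L$ closest to $\alpha_0$ with $\mathrm{Re}(\alpha_1)>\mathrm{Re}(\alpha_0)$. Then the Gaussian integers on $L$ are exactly $\alpha_n=\alpha_0+\delta n$, $n\in\mathbb{Z}$. The divisor set of $L$ is $\mathcal{D}(L)=\{\beta\in\mathbb{Z}[i]:\beta\mid\alpha_n\text{ for some }n\in\mathbb{Z}\}$. The function $\nu:\mathbb{Z}[i]\to\mathbb{Z}$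 is defined by $\nu(x+iy)=\frac{x^2+y^2}{\gcd(x,y)}$ for $x+iy\neq 0$, and $\nu(0)=0$. Divisibility of Gaussian integers is in $\mathbb{Z}[i]$. *)

theory Defs
  imports "HOL-Analysis.Analysis" "HOL-Number_Theory.Cong"
begin

datatype gauss_int = Gauss (ReZ: int) (ImZ: int)

lemma gauss_int_eq_iff: "x = y \<longleftrightarrow> ReZ x = ReZ y \<and> ImZ x = ImZ y"
  by (metis gauss_int.collapse)

instantiation gauss_int :: comm_ring_1
begin

definition zero_gauss_int :: gauss_int where "0 = Gauss 0 0"
definition one_gauss_int :: gauss_int where "1 = Gauss 1 0"
definition plus_gauss_int :: "gauss_int \<Rightarrow> gauss_int \<Rightarrow> gauss_int"
  where "x + y = Gauss (ReZ x + ReZ y) (ImZ x + ImZ y)"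
definition uminus_gauss_int :: "gauss_int \<Rightarrow> gauss_int"
  where "- x = Gauss (- ReZ x) (- ImZ x)"
definition minus_gauss_int :: "gauss_int \<Rightarrow> gauss_int \<Rightarrow> gauss_int"
  where "x - y = Gauss (ReZ x - ReZ y) (ImZ x - ImZ y)"
definition times_gauss_int :: "gauss_int \<Rightarrow> gauss_int \<Rightarrow> gauss_int"
  where "x * y = Gauss (ReZ x * ReZ y - ImZ x * ImZ y) (ReZ x * ImZ y + ImZ x * ReZ y)"

instance
  by standard
     (simp_all add: gauss_int_eq_iff zero_gauss_int_def one_gauss_int_def plus_gauss_int_def
        uminus_gauss_int_def minus_gauss_int_def times_gauss_int_def algebra_simps)

end

definition complex_of_gauss :: "gauss_int \<Rightarrow> complex"
  where "complex_of_gauss x = Complex (of_int (ReZ x)) (of_int (ImZ x))"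

lemma inj_complex_of_gauss: "inj complex_of_gauss"
  by (simp add: inj_def complex_of_gauss_def gauss_int_eq_iff)

lemma complex_of_gauss_simps:
  "complex_of_gauss 0 = 0" "complex_of_gauss 1 = 1"
  "complex_of_gauss (x + y) = complex_of_gauss x + complex_of_gauss y"
  "complex_of_gauss (- x) = - complex_of_gauss x"
  "complex_of_gauss (x - y) = complex_of_gauss x - complex_of_gauss y"
  "complex_of_gauss (x * y) = complex_of_gauss x * complex_of_gauss y"
  by (simp_all add: complex_of_gauss_def complex_eq_iff zero_gauss_int_def one_gauss_int_def
        plus_gauss_int_def uminus_gauss_int_def minus_gauss_int_def times_gauss_int_def)

definition gauss_norm :: "gauss_int \<Rightarrow> int"
  where "gauss_norm x = (ReZ x)\<^sup>2 + (ImZ x)\<^sup>2"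

text \<open>The integer division is exact, since the gcd divides both squares.\<close>
definition gauss_nu :: "gauss_int \<Rightarrow> int"
  where "gauss_nu x = (if x = 0 then 0 else gauss_norm x div gcd (ReZ x) (ImZ x))"

definition gauss_points :: "complex set \<Rightarrow> gauss_int set"
  where "gauss_points L = {x. complex_of_gauss x \<in> L}"

definition gaussian_line :: "complex set \<Rightarrow> bool"
  where "gaussian_line L \<longleftrightarrow> affine L \<and> aff_dim L = 1 \<and>
    (\<exists>x\<in>gauss_points L. \<exists>y\<in>gauss_points L. x \<noteq> y)"

definition primitive_gaussian_line :: "complex set \<Rightarrow> bool"
  where "primitive_gaussian_line L \<longleftrightarrow> gaussian_line L \<and>
    \<not> (\<exists>d. \<not> d dvd 1 \<and> (\<forall>x\<in>gauss_points L. d dvd x))"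

text \<open>
  The Gaussian integer of minimal norm. Two points of a Gaussian line that both have minimal norm
  have distinct real parts: on a vertical line the minimum is attained only on the real axis.
\<close>
definition line_base :: "complex set \<Rightarrow> gauss_int"
  where "line_base L = (THE x. x \<in> gauss_points L \<and>
    (\<forall>y\<in>gauss_points L. gauss_norm x \<le> gauss_norm y \<and>
       (gauss_norm y = gauss_norm x \<longrightarrow> ReZ y \<le> ReZ x)))"

definition vertical_line :: "complex set \<Rightarrow> bool"
  where "vertical_line L \<longleftrightarrow> (\<forall>z\<in>L. \<forall>w\<in>L. Re z = Re w)"

definition line_next :: "complex set \<Rightarrow> gauss_int"
  where "line_next L = (THE x. x \<in> gauss_points L \<and> ReZ (line_base L) < ReZ x \<and>
    (\<forall>y\<in>gauss_points L. ReZ (line_base L) < ReZ y \<longrightarrow>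
       gauss_norm (x - line_base L) \<le> gauss_norm (y - line_base L)))"

definition line_step :: "complex set \<Rightarrow> gauss_int"
  where "line_step L = (if vertical_line L then Gauss 0 1 else line_next L - line_base L)"

definition line_point :: "complex set \<Rightarrow> int \<Rightarrow> gauss_int"
  where "line_point L n = line_base L + line_step L * of_int n"

definition divisor_set :: "complex set \<Rightarrow> gauss_int set"
  where "divisor_set L = {d. \<exists>n. d dvd line_point L n}"

end

theory Submission
  imports Defs
begin

text \<open>
  If \<open>\<mu>\<close> divides \<open>\<alpha>\<^sub>m\<close>, then a common divisor of \<open>\<mu>\<close> and \<open>\<delta>\<close> divides every Gaussian
  integer on \<open>L\<close>, so by primitivity \<open>\<mu>\<close> and \<open>\<delta>\<close> are coprime. Hence \<open>\<mu> dvd \<alpha>\<^sub>s\<close> iff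
  \<open>\<mu> dvd \<delta> (s - m)\<close> iff \<open>\<mu> dvd s - m\<close>, and a rational integer is divisible by \<open>\<mu>\<close> iff it is
  divisible by \<open>\<nu>(\<mu>)\<close>. The statement thus reduces to the Chinese remainder theorem for integers.
\<close>

section \<open>Gaussian integers\<close>

lemma ReZ_ImZ_simps [simp]:
  "ReZ 0 = 0" "ImZ 0 = 0" "ReZ 1 = 1" "ImZ 1 = 0"
  "ReZ (x + y) = ReZ x + ReZ y" "ImZ (x + y) = ImZ x + ImZ y"
  "ReZ (- x) = - ReZ x" "ImZ (- x) = - ImZ x"
  "ReZ (x - y) = ReZ x - ReZ y" "ImZ (x - y) = ImZ x - ImZ y"
  "ReZ (x * y) = ReZ x * ReZ y - ImZ x * ImZ y"
  "ImZ (x * y) = ReZ x * ImZ y + ImZ x * ReZ y"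
  by (simp_all add: zero_gauss_int_def one_gauss_int_def plus_gauss_int_def
        uminus_gauss_int_def minus_gauss_int_def times_gauss_int_def)

lemma ReZ_ImZ_of_int [simp]: "ReZ (of_int n) = n" "ImZ (of_int n) = 0"
  by (induction n rule: int_induct[where k = 0]) simp_all

lemma gauss_norm_nonneg: "gauss_norm x \<ge> 0"
  by (simp add: gauss_norm_def)

lemma gauss_norm_pos: "x \<noteq> 0 \<Longrightarrow> gauss_norm x > 0"
  by (auto simp: gauss_norm_def gauss_int_eq_iff sum_power2_gt_zero_iff)

lemma gauss_norm_mult: "gauss_norm (x * y) = gauss_norm x * gauss_norm y"
  by (simp add: gauss_norm_def power2_eq_square algebra_simps)

lemma nearest_int_quotient:
  fixes m n :: int
  assumes "n > 0"
  obtains q where "2 * \<bar>m - q * n\<bar> \<le> n"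
proof
  \<comment> \<open>This \<open>q\<close> is the floor of \<open>m / n + 1 / 2\<close>, that is,
    \<open>m / n\<close> rounded to a nearest integer.\<close>
  define q r where "q = (2 * m + n) div (2 * n)" and "r = (2 * m + n) mod (2 * n)"
  have "2 * m + n = q * (2 * n) + r"
    unfolding q_def r_def by (rule div_mult_mod_eq[symmetric])
  then have "2 * (m - q * n) = r - n"
    by (simp add: algebra_simps)
  moreover have "0 \<le> r" "r < 2 * n"
    using assms by (simp_all add: r_def)
  ultimately show "2 * \<bar>m - q * n\<bar> \<le> n"
    by linarith
qed

text \<open>Rounding both coordinates of the exact quotient \<open>a / b\<close> leaves an error
  whose norm is at most 1/4 + 1/4, so the remainder has norm at most half that of
  \<open>b\<close>.\<close>

lemma gauss_division:
  assumes "b \<noteq> 0"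
  obtains q where "gauss_norm (a - q * b) < gauss_norm b"
proof -
  define N where "N = gauss_norm b"
  \<comment> \<open>The factor is the conjugate of \<open>b\<close>, so \<open>c / N\<close> is the
    exact quotient \<open>a / b\<close>. The remainder times this conjugate will be
    \<open>?e\<close>, which keeps the estimate within the integers.\<close>
  define c where "c = a * Gauss (ReZ b) (- ImZ b)"
  have N: "N > 0"
    using gauss_norm_pos[OF assms] by (simp add: N_def)
  obtain u where u: "2 * \<bar>ReZ c - u * N\<bar> \<le> N" using nearest_int_quotient[OF N] .
  obtain v where v: "2 * \<bar>ImZ c - v * N\<bar> \<le> N" using nearest_int_quotient[OF N] .
  let ?q = "Gauss u v"
  let ?e = "Gauss (ReZ c - u * N) (ImZ c - v * N)"
  have "(a - ?q * b) * Gauss (ReZ b) (- ImZ b) = ?e"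
    by (simp add: gauss_int_eq_iff c_def N_def gauss_norm_def power2_eq_square algebra_simps)
  then have "gauss_norm (a - ?q * b) * gauss_norm (Gauss (ReZ b) (- ImZ b)) = gauss_norm ?e"
    by (metis gauss_norm_mult)
  then have e: "gauss_norm (a - ?q * b) * N = gauss_norm ?e"
    by (simp add: N_def gauss_norm_def)
  have "(2 * \<bar>ReZ c - u * N\<bar>)\<^sup>2 \<le> N\<^sup>2" "(2 * \<bar>ImZ c - v * N\<bar>)\<^sup>2 \<le> N\<^sup>2"
    using u v by (intro power_mono; simp)+
  then have "4 * gauss_norm ?e \<le> 2 * N\<^sup>2"
    by (simp add: gauss_norm_def power_mult_distrib)
  then have "4 * gauss_norm (a - ?q * b) * N \<le> 2 * N * N"
    unfolding e[symmetric] by (simp add: power2_eq_square algebra_simps)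
  then have "4 * gauss_norm (a - ?q * b) \<le> 2 * N"
    using N by (metis mult_le_cancel_right_pos)
  then have "gauss_norm (a - ?q * b) < N"
    using N by linarith
  then show thesis
    using that by (simp add: N_def)
qed

text \<open>This is the Euclidean algorithm: \<open>(a, b)\<close> is replaced by
  \<open>(b, a - q * b)\<close>, and the norm of the second entry drops until it is 0.\<close>

lemma gauss_bezout: "\<exists>x y. x * a + y * b dvd a \<and> x * a + y * b dvd (b :: gauss_int)"
proof (induction "nat (gauss_norm b)" arbitrary: a b rule: less_induct)
  case less
  show ?case
  proof (cases "b = 0")
    case True
    then have "1 * a + 0 * b dvd a \<and> 1 * a + 0 * b dvd b" by simp
    then show ?thesis by blast
  next
    case False
    obtain q where q: "gauss_norm (a - q * b) < gauss_norm b"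
      using gauss_division[OF False] .
    then have "nat (gauss_norm (a - q * b)) < nat (gauss_norm b)"
      using gauss_norm_nonneg[of "a - q * b"] by linarith
    from less[OF this] obtain x y where g:
      "x * b + y * (a - q * b) dvd b" "x * b + y * (a - q * b) dvd a - q * b"
      by blast
    let ?g = "x * b + y * (a - q * b)"
    have "?g dvd (a - q * b) + q * b"
      using g by (intro dvd_add dvd_mult) auto
    moreover have "?g = y * a + (x - y * q) * b"
      by (simp add: algebra_simps)
    ultimately show ?thesis
      using g(1) by (metis diff_add_cancel)
  qed
qed

text \<open>Write \<mu> as \<open>g\<close> times a primitive Gaussian integer with coordinates
  \<open>x\<close>, \<open>y\<close>. Multiplying \<mu> by the conjugate of the primitive part gives
  exactly \<open>gauss_nu \<mu>\<close>, and coprimality of \<open>x\<close> and \<open>y\<close>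
  shows that no smaller positive integer is a multiple of \<mu>.\<close>

lemma gauss_dvd_of_int_iff: "\<mu> dvd of_int n \<longleftrightarrow> gauss_nu \<mu> dvd n"
proof (cases "\<mu> = 0")
  case True
  show ?thesis
    unfolding True by (simp add: gauss_nu_def) (simp add: gauss_int_eq_iff)
next
  case False
  define g where "g = gcd (ReZ \<mu>) (ImZ \<mu>)"
  have g: "g > 0"
    using False by (auto simp: g_def gauss_int_eq_iff)
  then obtain x y where xy: "ReZ \<mu> = x * g" "ImZ \<mu> = y * g" "coprime x y"
    using gcd_coprime_exists[of "ReZ \<mu>" "ImZ \<mu>"] unfolding g_def[symmetric] by blast
  have "gauss_norm \<mu> = (g * (x\<^sup>2 + y\<^sup>2)) * g"
    by (simp add: gauss_norm_def xy power2_eq_square algebra_simps)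
  then have nu: "gauss_nu \<mu> = g * (x\<^sup>2 + y\<^sup>2)"
    using g False by (simp add: gauss_nu_def flip: g_def)
  show ?thesis
  proof
    assume "\<mu> dvd of_int n"
    then obtain w where "of_int n = \<mu> * w" by (elim dvdE)
    then have n: "n = x * g * ReZ w - y * g * ImZ w" "0 = x * g * ImZ w + y * g * ReZ w"
      by (simp_all add: gauss_int_eq_iff xy)
    \<comment> \<open>This equation and the next one for \<open>n * y\<close> are the two
      coordinates of \<open>n = \<mu> * w\<close> multiplied by the conjugate of the primitive
      part.\<close>
    have "n * x = gauss_nu \<mu> * ReZ w"
    proof -
      have "n * x = gauss_nu \<mu> * ReZ w - y * (x * g * ImZ w + y * g * ReZ w)"
        unfolding n(1) nu by (simp add: power2_eq_square algebra_simps)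
      then show ?thesis using n(2) by simp
    qed
    moreover have "n * y = gauss_nu \<mu> * (- ImZ w)"
    proof -
      have "n * y = gauss_nu \<mu> * (- ImZ w) + x * (x * g * ImZ w + y * g * ReZ w)"
        unfolding n(1) nu by (simp add: power2_eq_square algebra_simps)
      then show ?thesis using n(2) by simp
    qed
    ultimately have "gauss_nu \<mu> dvd gcd (n * x) (n * y)"
      by (metis dvd_triv_left gcd_greatest)
    then show "gauss_nu \<mu> dvd n"
      using xy(3) by (simp add: gcd_mult_left)
  next
    assume "gauss_nu \<mu> dvd n"
    then obtain k where "n = gauss_nu \<mu> * k" by (elim dvdE)
    then have "of_int n = \<mu> * Gauss (x * k) (- y * k)"
      by (simp add: gauss_int_eq_iff xy nu power2_eq_square algebra_simps)
    then show "\<mu> dvd of_int n" by (metis dvd_triv_left)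
  qed
qed

section \<open>Gaussian lines\<close>

lemma int_arg_min_on:
  fixes f :: "'a \<Rightarrow> int"
  assumes "a \<in> A" "\<And>x. x \<in> A \<Longrightarrow> l \<le> f x"
  obtains m where "m \<in> A" "\<forall>y\<in>A. f m \<le> f y"
proof -
  obtain m where m: "m \<in> A" "\<And>y. y \<in> A \<Longrightarrow> nat (f m - l) \<le> nat (f y - l)"
    using ex_has_least_nat[of "\<lambda>x. x \<in> A" a "\<lambda>x. nat (f x - l)"] assms(1) by blast
  have "f m \<le> f y" if "y \<in> A" for y
    using m(2)[OF that] assms(2)[OF that] assms(2)[OF m(1)] by linarith
  with m(1) show thesis by (intro that) auto
qed

text \<open>Two distinct Gaussian points \<open>p\<close>, \<open>q\<close> of \<open>L\<close> span
  it, with direction \<open>(u, v)\<close>. Eliminating the real parameter leaves an equation over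
  the integers. As \<open>u\<close> is nonzero, a point is determined by its real part, which later
  yields uniqueness.\<close>

lemma gaussian_line_equation:
  assumes "gaussian_line L" "\<not> vertical_line L"
  obtains u p v where "u \<noteq> 0" "p \<in> gauss_points L"
    "gauss_points L = {x. (ReZ x - ReZ p) * v = (ImZ x - ImZ p) * u}"
proof -
  from assms(1) obtain p q where pq: "p \<in> gauss_points L" "q \<in> gauss_points L" "p \<noteq> q"
    and L: "affine L" "aff_dim L = 1"
    by (auto simp: gaussian_line_def)
  define P Q where "P = complex_of_gauss p" and "Q = complex_of_gauss q"
  have PQ: "P \<in> L" "Q \<in> L" "P \<noteq> Q"
    using pq inj_complex_of_gauss by (auto simp: gauss_points_def P_def Q_def inj_eq)
  have "affine hull {P, Q} = affine hull L"
    using PQ L by (intro aff_dim_eq_full_gen[THEN iffD1]) (auto simp: aff_dim_2)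
  then have L_eq: "L = range (\<lambda>t. P + t *\<^sub>R (Q - P))"
    using L(1) by (simp add: affine_hull_2_alt hull_same)
  define u v where "u = ReZ q - ReZ p" and "v = ImZ q - ImZ p"
  have uv: "Q - P = Complex (of_int u) (of_int v)"
    by (simp add: P_def Q_def u_def v_def complex_of_gauss_def complex_eq_iff)
  have u: "u \<noteq> 0"
    using assms(2) by (auto simp: vertical_line_def L_eq uv)
  show thesis
  proof
    show "u \<noteq> 0" "p \<in> gauss_points L" by fact+
    have "x \<in> gauss_points L \<longleftrightarrow> (ReZ x - ReZ p) * v = (ImZ x - ImZ p) * u" for x
    proof
      assume "x \<in> gauss_points L"
      then obtain t where "complex_of_gauss x = P + t *\<^sub>R (Q - P)"
        by (auto simp: gauss_points_def L_eq)
      then have "real_of_int (ReZ x) = ReZ p + t * u" "real_of_int (ImZ x) = ImZ p + t * v"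
        unfolding uv by (auto simp: P_def complex_of_gauss_def complex_eq_iff)
      then have "(real_of_int (ReZ x) - ReZ p) * v = (real_of_int (ImZ x) - ImZ p) * u"
        by (simp add: algebra_simps)
      then show "(ReZ x - ReZ p) * v = (ImZ x - ImZ p) * u"
        by (metis of_int_diff of_int_eq_iff of_int_mult)
    next
      assume *: "(ReZ x - ReZ p) * v = (ImZ x - ImZ p) * u"
      define t where "t = (real_of_int (ReZ x) - ReZ p) / u"
      have "(real_of_int (ReZ x) - ReZ p) * v = (real_of_int (ImZ x) - ImZ p) * u"
        using * by (metis of_int_diff of_int_mult)
      then have "complex_of_gauss x = P + t *\<^sub>R (Q - P)"
        using u unfolding uv
        by (simp add: P_def complex_of_gauss_def complex_eq_iff t_def field_simps)
      then show "x \<in> gauss_points L"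
        by (auto simp: gauss_points_def L_eq)
    qed
    then show "gauss_points L = {x. (ReZ x - ReZ p) * v = (ImZ x - ImZ p) * u}"
      by blast
  qed
qed

text \<open>The definite description must be shown to denote: the norm is minimized first, then the
  real part is maximized among the minimizers, and the real part fixes the point.\<close>

lemma line_base_in_gauss_points:
  assumes "gaussian_line L" "\<not> vertical_line L"
  shows "line_base L \<in> gauss_points L"
proof -
  obtain u p v where u: "u \<noteq> 0" and p: "p \<in> gauss_points L"
    and L: "gauss_points L = {x. (ReZ x - ReZ p) * v = (ImZ x - ImZ p) * u}"
    using gaussian_line_equation[OF assms] .
  obtain m where m: "m \<in> gauss_points L"
    and m_le: "\<forall>y\<in>gauss_points L. gauss_norm m \<le> gauss_norm y"
    using int_arg_min_on[OF p gauss_norm_nonneg] .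
  define S where "S = {x \<in> gauss_points L. gauss_norm x = gauss_norm m}"
  \<comment> \<open>An integer is at most its square, so real parts on \<open>S\<close> are bounded
    by the minimal norm and a maximum exists.\<close>
  have S_le: "- gauss_norm m \<le> - ReZ x" if "x \<in> S" for x
  proof -
    have "ReZ x \<le> (ReZ x)\<^sup>2"
      by (cases "ReZ x \<le> 0") (auto intro: order_trans[OF _ zero_le_power2] self_le_power)
    also have "\<dots> \<le> gauss_norm x" by (simp add: gauss_norm_def)
    finally show ?thesis using that by (simp add: S_def)
  qed
  have "m \<in> S" using m by (simp add: S_def)
  from int_arg_min_on[OF this S_le]
  obtain b where b: "b \<in> S" "\<forall>y\<in>S. - ReZ b \<le> - ReZ y" .
  have "\<exists>!x. x \<in> gauss_points L \<and>
    (\<forall>y\<in>gauss_points L. gauss_norm x \<le> gauss_norm y \<and>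
       (gauss_norm y = gauss_norm x \<longrightarrow> ReZ y \<le> ReZ x))"
  proof (rule ex1I[of _ b])
    show "b \<in> gauss_points L \<and>
      (\<forall>y\<in>gauss_points L. gauss_norm b \<le> gauss_norm y \<and>
         (gauss_norm y = gauss_norm b \<longrightarrow> ReZ y \<le> ReZ b))"
      using b m_le by (auto simp: S_def)
  next
    fix x assume x: "x \<in> gauss_points L \<and>
      (\<forall>y\<in>gauss_points L. gauss_norm x \<le> gauss_norm y \<and>
         (gauss_norm y = gauss_norm x \<longrightarrow> ReZ y \<le> ReZ x))"
    then have "x \<in> S"
      using m m_le by (auto simp: S_def intro: antisym)
    then have "ReZ x = ReZ b"
      using b x by (auto simp: S_def intro: antisym)
    moreover have "(ReZ x - ReZ p) * v = (ImZ x - ImZ p) * u"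
      "(ReZ b - ReZ p) * v = (ImZ b - ImZ p) * u"
      using b(1) x by (auto simp: L S_def)
    ultimately show "x = b"
      using u by (auto simp: gauss_int_eq_iff)
  qed
  from theI'[OF this] show ?thesis
    by (simp add: line_base_def)
qed

text \<open>Division with remainder on real parts: subtracting a suitable multiple of \<delta> from
  \<open>y\<close> gives a point of \<open>L\<close> whose real part lies between that of
  \<open>a\<close> (inclusive) and that of \<open>m\<close> (exclusive). By the choice of
  \<open>m\<close> it can only be \<open>a\<close>.\<close>

lemma gauss_points_eq_line_point:
  assumes "gaussian_line L" "\<not> vertical_line L" "y \<in> gauss_points L"
  obtains n where "y = line_point L n"
proof -
  obtain u p v where u: "u \<noteq> 0" and p: "p \<in> gauss_points L"
    and L: "gauss_points L = {x. (ReZ x - ReZ p) * v = (ImZ x - ImZ p) * u}"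
    using gaussian_line_equation[OF assms(1,2)] .
  define a where "a = line_base L"
  have a: "a \<in> gauss_points L"
    using line_base_in_gauss_points[OF assms(1,2)] by (simp add: a_def)
  then have La: "x \<in> gauss_points L \<longleftrightarrow> (ReZ x - ReZ a) * v = (ImZ x - ImZ a) * u" for x
    using a unfolding L by (auto simp: algebra_simps)
  \<comment> \<open>Distance from \<open>a\<close> along the line is proportional to the horizontal
    offset, so the closest point to the right of \<open>a\<close> is the one with the least real
    part.\<close>
  have norm: "gauss_norm (x - a) * u\<^sup>2 = (ReZ x - ReZ a)\<^sup>2 * (u\<^sup>2 + v\<^sup>2)"
    if "x \<in> gauss_points L" for x
  proof -
    have "((ImZ x - ImZ a) * u)\<^sup>2 = ((ReZ x - ReZ a) * v)\<^sup>2"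
      using that by (simp add: La)
    then show ?thesis
      by (simp add: gauss_norm_def power_mult_distrib distrib_left distrib_right)
  qed
  have uv: "u\<^sup>2 > 0" "u\<^sup>2 + v\<^sup>2 > 0"
    using u by (simp_all add: sum_power2_gt_zero_iff)
  have norm_le: "gauss_norm (x - a) \<le> gauss_norm (z - a) \<longleftrightarrow> ReZ x \<le> ReZ z"
    if "x \<in> gauss_points L" "z \<in> gauss_points L" "ReZ a < ReZ x" "ReZ a < ReZ z" for x z
  proof -
    have "gauss_norm (x - a) \<le> gauss_norm (z - a) \<longleftrightarrow>
        gauss_norm (x - a) * u\<^sup>2 \<le> gauss_norm (z - a) * u\<^sup>2"
      using uv by simp
    also have "\<dots> \<longleftrightarrow> (ReZ x - ReZ a)\<^sup>2 \<le> (ReZ z - ReZ a)\<^sup>2"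
      using uv by (simp add: norm that)
    also have "\<dots> \<longleftrightarrow> ReZ x \<le> ReZ z"
      using that by (simp add: power_mono_iff)
    finally show ?thesis .
  qed
  have eqI: "x = z" if "x \<in> gauss_points L" "z \<in> gauss_points L" "ReZ x = ReZ z" for x z
    using that u by (auto simp: La gauss_int_eq_iff)
  define P where "P = {x \<in> gauss_points L. ReZ a < ReZ x}"
  \<comment> \<open>The witness is \<open>a\<close> moved by the direction \<open>(u, v)\<close>,
    with its sign chosen so that it points to the right.\<close>
  have P_ne: "a + Gauss \<bar>u\<bar> (sgn u * v) \<in> P"
    using u by (auto simp: P_def La abs_if)
  have P_le: "ReZ a \<le> ReZ x" if "x \<in> P" for x
    using that by (simp add: P_def)
  obtain m where m: "m \<in> P" and m_le: "\<forall>y\<in>P. ReZ m \<le> ReZ y"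
    using int_arg_min_on[OF P_ne P_le] .
  have "line_next L = m"
    unfolding line_next_def a_def[symmetric]
  proof (rule the_equality)
    show "m \<in> gauss_points L \<and> ReZ a < ReZ m \<and>
      (\<forall>y\<in>gauss_points L. ReZ a < ReZ y \<longrightarrow> gauss_norm (m - a) \<le> gauss_norm (y - a))"
      using m m_le by (auto simp: P_def norm_le)
  next
    fix x assume x: "x \<in> gauss_points L \<and> ReZ a < ReZ x \<and>
      (\<forall>y\<in>gauss_points L. ReZ a < ReZ y \<longrightarrow> gauss_norm (x - a) \<le> gauss_norm (y - a))"
    then have "ReZ x \<le> ReZ m" "ReZ m \<le> ReZ x"
      using m m_le by (auto simp: P_def norm_le)
    then show "x = m" using x m by (intro eqI) (auto simp: P_def)
  qed
  then have step: "line_step L = m - a"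
    using assms(2) by (simp add: line_step_def a_def)
  define c where "c = ReZ m - ReZ a"
  have c: "c > 0" using m by (simp add: P_def c_def)
  define n where "n = (ReZ y - ReZ a) div c"
  let ?r = "y - (m - a) * of_int n"
  have "(ReZ m - ReZ a) * v = (ImZ m - ImZ a) * u" "(ReZ y - ReZ a) * v = (ImZ y - ImZ a) * u"
    using m assms(3) by (auto simp: P_def La)
  then have "(ReZ y - ReZ a) * v - n * ((ReZ m - ReZ a) * v)
      = (ImZ y - ImZ a) * u - n * ((ImZ m - ImZ a) * u)"
    by simp
  then have r: "?r \<in> gauss_points L"
    by (simp add: La algebra_simps)
  have Re_r: "ReZ ?r = ReZ a + (ReZ y - ReZ a) mod c"
    by (simp add: n_def c_def flip: minus_div_mult_eq_mod)
  have "ReZ ?r < ReZ m"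
    unfolding Re_r using pos_mod_bound[OF c, of "ReZ y - ReZ a"] unfolding c_def by linarith
  then have "?r \<notin> P" using m_le by fastforce
  then have "\<not> ReZ a < ReZ ?r"
    using r unfolding P_def by blast
  moreover have "ReZ a \<le> ReZ ?r"
    unfolding Re_r using pos_mod_sign[OF c, of "ReZ y - ReZ a"] by linarith
  ultimately have "ReZ ?r = ReZ a"
    by (meson antisym not_le_imp_less)
  then have "?r = a"
    using r a by (intro eqI)
  then have "y = line_point L n"
    by (simp add: line_point_def step flip: a_def) (metis diff_add_cancel)
  then show thesis by (rule that)
qed

lemma primitive_line_common_divisor:
  assumes "primitive_gaussian_line L" "d dvd line_point L m" "d dvd line_step L"
  shows "d dvd 1"
proof (cases "vertical_line L")
  case True
  \<comment> \<open>On a vertical line \<delta> is the unit \<open>i\<close>, so every divisor of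
    \<delta> is a unit.\<close>
  have "Gauss 0 1 dvd 1"
    by (rule dvdI[of _ _ "Gauss 0 (-1)"]) (simp add: gauss_int_eq_iff)
  then show ?thesis
    using assms(3) True dvd_trans by (auto simp: line_step_def)
next
  case False
  have L: "gaussian_line L"
    using assms(1) by (simp add: primitive_gaussian_line_def)
  have "d dvd y" if y: "y \<in> gauss_points L" for y
  proof -
    obtain n where "y = line_point L n"
      using gauss_points_eq_line_point[OF L False y] .
    then have "y = line_point L m + line_step L * of_int (n - m)"
      by (simp add: line_point_def algebra_simps)
    then show ?thesis using assms(2,3) by simp
  qed
  then show ?thesis
    using assms(1) unfolding primitive_gaussian_line_def by blast
qed

lemma dvd_line_point_iff:
  assumes "primitive_gaussian_line L" "\<mu> dvd line_point L m"
  shows "\<mu> dvd line_point L s \<longleftrightarrow> [s = m] (mod gauss_nu \<mu>)"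
proof -
  define \<delta> where "\<delta> = line_step L"
  obtain x y where g: "x * \<mu> + y * \<delta> dvd \<mu>" "x * \<mu> + y * \<delta> dvd \<delta>"
    using gauss_bezout by blast
  have "x * \<mu> + y * \<delta> dvd 1"
    using primitive_line_common_divisor[OF assms(1) dvd_trans[OF g(1) assms(2)]] g(2)
    by (simp add: \<delta>_def)
  \<comment> \<open>The Bezout combination is a unit with inverse \<open>e\<close>. Multiplying this
    identity by \<open>s - m\<close> will split \<open>s - m\<close> into two multiples of
    \<mu>.\<close>
  then obtain e where e: "1 = (x * \<mu> + y * \<delta>) * e" by (elim dvdE)
  have "line_point L s = line_point L m + \<delta> * of_int (s - m)"
    by (simp add: line_point_def \<delta>_def algebra_simps)
  then have "\<mu> dvd line_point L s \<longleftrightarrow> \<mu> dvd \<delta> * of_int (s - m)"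
    using assms(2) by (simp add: dvd_add_right_iff)
  also have "\<dots> \<longleftrightarrow> \<mu> dvd of_int (s - m)"
  proof
    assume *: "\<mu> dvd \<delta> * of_int (s - m)"
    have "of_int (s - m) = (x * \<mu> + y * \<delta>) * e * of_int (s - m)"
      using e by simp
    also have "\<dots> = \<mu> * (x * e * of_int (s - m)) + (\<delta> * of_int (s - m)) * (y * e)"
      by (simp add: algebra_simps)
    finally have eq: "of_int (s - m) =
      \<mu> * (x * e * of_int (s - m)) + (\<delta> * of_int (s - m)) * (y * e)" .
    show "\<mu> dvd of_int (s - m)"
      by (subst eq) (intro dvd_add dvd_triv_left dvd_mult2 *)
  qed simp
  also have "\<dots> \<longleftrightarrow> [s = m] (mod gauss_nu \<mu>)"
    by (simp only: gauss_dvd_of_int_iff cong_iff_dvd_diff)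
  finally show ?thesis .
qed

section \<open>The Chinese remainder theorem\<close>

text \<open>The equivalence says that the solutions form exactly one residue class, so it carries
  existence and uniqueness together. The induction merges the class found for \<open>A\<close> with
  the one modulo \<open>N j\<close>.\<close>

lemma chinese_remainder_int_iff:
  fixes N c :: "'a \<Rightarrow> int"
  assumes "finite A" "pairwise (\<lambda>i j. coprime (N i) (N j)) A"
  shows "\<exists>t. \<forall>s. (\<forall>i\<in>A. [s = c i] (mod N i)) \<longleftrightarrow> [s = t] (mod (\<Prod>i\<in>A. N i))"
  using assms
proof (induction A rule: finite_induct)
  case empty
  then show ?case by simp
next
  case (insert j A)
  then obtain t where t: "\<And>s. (\<forall>i\<in>A. [s = c i] (mod N i)) \<longleftrightarrow> [s = t] (mod prod N A)"
    by (auto simp: pairwise_insert)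
  have cop: "coprime (N j) (prod N A)"
    using insert by (intro prod_coprime_right) (auto simp: pairwise_insert)
  then obtain z where z: "[z = c j] (mod N j)" "[z = t] (mod prod N A)"
    using binary_chinese_remainder_int by blast
  have "(\<forall>i\<in>insert j A. [s = c i] (mod N i)) \<longleftrightarrow> [s = z] (mod prod N (insert j A))" for s
  proof -
    \<comment> \<open>Since \<open>z\<close> lies in both classes, each can be recentred at
      \<open>z\<close>.\<close>
    have "(\<forall>i\<in>insert j A. [s = c i] (mod N i)) \<longleftrightarrow>
        [s = z] (mod N j) \<and> [s = z] (mod prod N A)"
      using z t by (metis cong_sym cong_trans insert_iff)
    also have "\<dots> \<longleftrightarrow> [s = z] (mod N j * prod N A)"
      using coprime_cong_mult[OF _ _ cop] by (metis cong_modulus_mult mult.commute)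
    finally show ?thesis using insert by simp
  qed
  then show ?case by blast
qed

theorem theorem8:
  fixes L :: "complex set" and k :: nat and \<mu> :: "nat \<Rightarrow> gauss_int" and b :: "nat \<Rightarrow> int"
  assumes "primitive_gaussian_line L"
    and "\<And>i. i \<in> {1..k} \<Longrightarrow> \<mu> i \<in> divisor_set L"
    and "pairwise (\<lambda>i j. coprime (gauss_nu (\<mu> i)) (gauss_nu (\<mu> j))) {1..k}"
  shows "\<exists>t::int. \<forall>s::int. (\<forall>i\<in>{1..k}. \<mu> i dvd line_point L (s + b i)) \<longleftrightarrow>
           [s = t] (mod (\<Prod>i\<in>{1..k}. gauss_nu (\<mu> i)))"
proof -
  have "\<exists>m. \<forall>i\<in>{1..k}. \<mu> i dvd line_point L (m i)"
    using assms(2) by (intro bchoice) (auto simp: divisor_set_def)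
  then obtain m where m: "\<And>i. i \<in> {1..k} \<Longrightarrow> \<mu> i dvd line_point L (m i)"
    by blast
  \<comment> \<open>The arbitrary shift \<open>b i\<close> only moves the required residue from
    \<open>m i\<close> to \<open>m i - b i\<close>, leaving the modulus unchanged.\<close>
  have "\<mu> i dvd line_point L (s + b i) \<longleftrightarrow> [s = m i - b i] (mod gauss_nu (\<mu> i))"
    if "i \<in> {1..k}" for i s
    unfolding dvd_line_point_iff[OF assms(1) m[OF that]]
    by (simp only: cong_iff_dvd_diff diff_diff_eq2)
  then have "(\<forall>i\<in>{1..k}. \<mu> i dvd line_point L (s + b i)) \<longleftrightarrow>
      (\<forall>i\<in>{1..k}. [s = m i - b i] (mod gauss_nu (\<mu> i)))" for s
    by (intro ball_cong refl) blast
  then show ?thesis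
    using chinese_remainder_int_iff[OF finite_atLeastAtMost assms(3), of "\<lambda>i. m i - b i"]
    by (simp only:)
qed

end
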